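(* Let $d_{22}(x:y)$, $(x:y)\in\mathbb{P}^1(\mathbb{C})$, be the family of $3$-dimensional complex associative algebras given in the context, where $d_{22}(x:y)\cong d_{22}(y:x)$. (i) If $(x:y)\notin\{(1:0),(0:1),(1:1),(1:-1)\}$, then $d_{22}(x:y)$ deforms only along the family: for every one-parameter deformation $d_t$ of $d_{22}(x:y)$ and every sufficiently small $t$, $d_t$ is isomorphic to a member of the family $d_{22}$; and it does deform smoothly along the family. (ii) $d_{22}(1:0)$ has jump deformations to $d_3,d_4,d_9,d_{10},d_{11},d_{13},d_{17}$, and it deforms smoothly along the family $d_{22}$. (iii) $d_{22}(1:1)$ has jump deformations to $d_2,d_5,d_6,d_{12},d_{14},d_{16},d_{19}$, and it deforms along the family $d_{22}$. (iv) $d_{22}(1:-1)$ has a jump deformation to $d_7$, and it deforms along the family $d_{22}$.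
   Context: Associative algebras are not assumed unital or commutative. $V$ is a complex vector space with basis $e_1,e_2,e_3$, and $\psi^{i,j}_k$ denotes the bilinear map $V\times V\to V$ with $\psi^{i,j}_k(e_i,e_j)=e_k$ and $\psi^{i,j}_k(e_m,e_n)=0$ for $(m,n)\neq(i,j)$. An algebra structure is identified with its product $d$. A one-parameter deformation of $d$ is a family $d_t=d+t\psi_1+t^2\psi_2+\cdots$ of associative products on $V$ (with bilinear $\psi_i:V\times V\to V$), given by a power series convergent for small $t$. It is a jump deformation from $d$ to a non-isomorphic structure $d'$ if $d_t$ is isomorphic to $d'$ for all sufficiently small $t\neq0$; it is a smooth deformation if the $d_t$ are pairwise non-isomorphic for all sufficiently small $t$. "Deforms (smoothly) along the family" means that there is a smooth deformation $d_t$ with each $d_t$ isomorphic to a member of the family $d_{22}$. The products are: $d_2=\psi^{1,1}_1+\psi^{2,2}_3$; $d_3=\psi^{1,1}_1+\psi^{1,3}_3$; $d_4=\psi^{1,1}_1+\psi^{3,1}_3$; $d_5=\psi^{1,1}_1+\psi^{1,3}_3+\psi^{3,1}_3$; $d_6=\psi^{1,1}_1+\psi^{3,3}_3$; $d_7=\psi^{1,1}_1+\psi^{2,1}_2+\psi^{1,3}_3$; $d_9=\psi^{1,1}_1+\psi^{2,1}_2+\psi^{1,3}_3+\psi^{3,1}_3$; $d_{10}=\psi^{1,1}_1+\psi^{2,1}_2+\psi^{3,3}_3$; $d_{11}=\psi^{1,1}_1+\psi^{2,2}_2+\psi^{2,3}_3$; $d_{12}=\psi^{1,1}_1+\psi^{2,2}_2+\psi^{2,3}_3+\psi^{3,2}_3$;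 $d_{13}=\psi^{1,1}_1+\psi^{2,2}_2+\psi^{2,3}_3+\psi^{3,1}_3$; $d_{14}=\psi^{1,1}_1+\psi^{2,2}_2+\psi^{3,3}_3$; $d_{16}=\psi^{1,1}_2+\psi^{1,2}_3+\psi^{2,1}_3$; $d_{17}=\psi^{1,1}_1+\psi^{1,1}_2+\psi^{1,2}_2+\psi^{2,1}_2+\psi^{1,3}_3$; $d_{19}=\psi^{3,3}_3+\psi^{1,1}_2+\psi^{1,3}_1+\psi^{3,1}_1+\psi^{2,3}_2+\psi^{3,2}_2$; $d_{22}(x:y)=x\,\psi^{1,2}_3+y\,\psi^{2,1}_3$ for $(x:y)\in\mathbb{P}^1(\mathbb{C})$.
   Formalization: In (iii) and (iv) the deformation along the family has its d_t pairwise non-isomorphic only for small real t: for complex t the isomorphism invariant at (1:1) and (1:-1) is a power series of order at least 2, or zero, so it is never injective near 0. *)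

theory Defs
  imports "HOL-Analysis.Analysis" "HOL-Library.Function_Algebras"
begin

text \<open>
  \<open>V = complex^3\<close> with basis \<open>axis 1 1, axis 2 1, axis 3 1\<close>. A product is a curried map on \<open>V\<close>;
  sums of products are pointwise (\<^theory>\<open>HOL-Library.Function_Algebras\<close>).
\<close>

type_synonym V = "complex^3"
type_synonym product = "V \<Rightarrow> V \<Rightarrow> V"

abbreviation clinear :: "(V \<Rightarrow> V) \<Rightarrow> bool" where
  "clinear \<equiv> Vector_Spaces.linear (*s) (*s)"

definition cbilinear :: "product \<Rightarrow> bool" where
  "cbilinear m \<longleftrightarrow> (\<forall>u. clinear (\<lambda>v. m u v)) \<and> (\<forall>v. clinear (\<lambda>u. m u v))"

definition assoc_product :: "product \<Rightarrow> bool" where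
  "assoc_product m \<longleftrightarrow> cbilinear m \<and> (\<forall>u v w. m (m u v) w = m u (m v w))"

definition isomorphic :: "product \<Rightarrow> product \<Rightarrow> bool" (infix \<open>\<simeq>\<close> 50) where
  "m \<simeq> n \<longleftrightarrow> (\<exists>f. clinear f \<and> bij f \<and> (\<forall>u v. f (m u v) = n (f u) (f v)))"

definition psi :: "3 \<Rightarrow> 3 \<Rightarrow> 3 \<Rightarrow> product" where
  "psi i j k = (\<lambda>u v. axis k (u $ i * v $ j))"

definition d2 :: product where "d2 = psi 1 1 1 + psi 2 2 3"
definition d3 :: product where "d3 = psi 1 1 1 + psi 1 3 3"
definition d4 :: product where "d4 = psi 1 1 1 + psi 3 1 3"
definition d5 :: product where "d5 = psi 1 1 1 + psi 1 3 3 + psi 3 1 3"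
definition d6 :: product where "d6 = psi 1 1 1 + psi 3 3 3"
definition d7 :: product where "d7 = psi 1 1 1 + psi 2 1 2 + psi 1 3 3"
definition d9 :: product where "d9 = psi 1 1 1 + psi 2 1 2 + psi 1 3 3 + psi 3 1 3"
definition d10 :: product where "d10 = psi 1 1 1 + psi 2 1 2 + psi 3 3 3"
definition d11 :: product where "d11 = psi 1 1 1 + psi 2 2 2 + psi 2 3 3"
definition d12 :: product where "d12 = psi 1 1 1 + psi 2 2 2 + psi 2 3 3 + psi 3 2 3"
definition d13 :: product where "d13 = psi 1 1 1 + psi 2 2 2 + psi 2 3 3 + psi 3 1 3"
definition d14 :: product where "d14 = psi 1 1 1 + psi 2 2 2 + psi 3 3 3"
definition d16 :: product where "d16 = psi 1 1 2 + psi 1 2 3 + psi 2 1 3"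
definition d17 :: product where
  "d17 = psi 1 1 1 + psi 1 1 2 + psi 1 2 2 + psi 2 1 2 + psi 1 3 3"
definition d19 :: product where
  "d19 = psi 3 3 3 + psi 1 1 2 + psi 1 3 1 + psi 3 1 1 + psi 2 3 2 + psi 3 2 2"

text \<open>
  A point \<open>(x:y)\<close> of the projective line is given by homogeneous coordinates
  \<open>(x, y) \<noteq> (0, 0)\<close>; the lemma \<open>d22_proj_eq\<close> below says that the isomorphism class of
  \<open>d22 x y\<close> depends only on the point.
\<close>

definition d22 :: "complex \<Rightarrow> complex \<Rightarrow> product" where
  "d22 x y = (\<lambda>u v. x *s psi 1 2 3 u v + y *s psi 2 1 3 u v)"

definition proj_eq :: "complex \<times> complex \<Rightarrow> complex \<times> complex \<Rightarrow> bool" where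
  "proj_eq p q \<longleftrightarrow> (\<exists>c. c \<noteq> 0 \<and> q = (c * fst p, c * snd p))"

lemma d22_proj_eq:
  assumes "proj_eq (x, y) (x', y')"
  shows "d22 x y \<simeq> d22 x' y'"
proof -
  obtain c where c: "c \<noteq> 0" "x' = c * x" "y' = c * y"
    using assms by (auto simp: proj_eq_def)
  define g :: "complex \<Rightarrow> V \<Rightarrow> V" where
    "g = (\<lambda>a v. \<chi> i. if i = 3 then a * v $ i else v $ i)"
  have lin: "clinear (g c)"
    unfolding g_def by unfold_locales (auto simp: vec_eq_iff algebra_simps)
  have "bij (g c)"
    by (rule bij_betw_byWitness[where f' = "g (inverse c)"])
      (use c in \<open>auto simp: g_def vec_eq_iff\<close>)
  moreover have "g c (d22 x y u v) = d22 x' y' (g c u) (g c v)" for u v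
    using c by (auto simp: g_def d22_def psi_def axis_def vec_eq_iff algebra_simps)
  ultimately show ?thesis
    using lin unfolding isomorphic_def by blast
qed

definition in_family_d22 :: "product \<Rightarrow> bool" where
  "in_family_d22 m \<longleftrightarrow> (\<exists>x y. (x, y) \<noteq> (0, 0) \<and> m \<simeq> d22 x y)"

text \<open>The parameter \<open>t\<close> of a deformation is complex; \<open>\<psi> 0\<close> is the undeformed product.\<close>

definition deformation :: "product \<Rightarrow> (complex \<Rightarrow> product) \<Rightarrow> bool" where
  "deformation m D \<longleftrightarrow> (\<exists>\<psi> :: nat \<Rightarrow> product.
     \<psi> 0 = m \<and> (\<forall>k. cbilinear (\<psi> k)) \<and>
     (\<forall>\<^sub>F t in nhds 0. (\<forall>u v. (\<lambda>k. t ^ k *s \<psi> k u v) sums D t u v) \<and> assoc_product (D t)))"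

definition has_jump_deformation :: "product \<Rightarrow> product \<Rightarrow> bool" where
  "has_jump_deformation m m' \<longleftrightarrow> \<not> m \<simeq> m' \<and>
     (\<exists>D. deformation m D \<and> (\<forall>\<^sub>F t in at 0. D t \<simeq> m'))"

text \<open>
  \<open>K\<close> is the set of parameters that are compared, either all of \<open>\<complex>\<close> or only \<open>\<real>\<close>. The choice
  matters at the points \<open>(1:1)\<close> and \<open>(1:-1)\<close>, which are the fixed points of the involution
  \<open>(x:y) \<mapsto> (y:x)\<close>. Identify isomorphic members of the family: the quotient has the
  local coordinate \<open>((x - y) / (x + y))\<^sup>2\<close> at \<open>(1:1)\<close> (its inverse at \<open>(1:-1)\<close>). Along any
  deformation inside the family this coordinate is a convergent power series in \<open>t\<close> of order at
  least 2 (or zero), hence never injective for complex \<open>t\<close> near 0, whereas it can be injective for real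
  \<open>t\<close>, as \<open>(t + \<i> t\<^sup>2)\<^sup>2\<close> is.
\<close>

definition smooth_deformation :: "complex set \<Rightarrow> product \<Rightarrow> (complex \<Rightarrow> product) \<Rightarrow> bool" where
  "smooth_deformation K m D \<longleftrightarrow> deformation m D \<and>
     (\<exists>\<epsilon>>0. \<forall>s\<in>K. \<forall>t\<in>K. norm s < \<epsilon> \<longrightarrow> norm t < \<epsilon> \<longrightarrow> s \<noteq> t \<longrightarrow> \<not> D s \<simeq> D t)"

definition deforms_along_d22 :: "complex set \<Rightarrow> product \<Rightarrow> bool" where
  "deforms_along_d22 K m \<longleftrightarrow>
     (\<exists>D. smooth_deformation K m D \<and> (\<forall>\<^sub>F t in nhds 0. in_family_d22 (D t)))"

end

theory Submission
  imports Defs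
begin

text \<open>
  A product \<open>d22 x y\<close> is the bilinear form \<open>G\<close> with matrix \<open>((0, x), (y, 0))\<close> on the plane
  \<open>V / \<langle>e3\<rangle>\<close>, with values in the line \<open>\<langle>e3\<rangle>\<close>. An isomorphism is a congruence of such forms up
  to a scalar. Comparing determinants and skew parts shows that \<open>d22 x y\<close> and \<open>d22 x' y'\<close> are
  isomorphic only if \<open>(x':y')\<close> is \<open>(x:y)\<close> or \<open>(y:x)\<close> (\<open>d22_isomorphic_imp\<close>). This yields the
  smooth deformations inside the family: away from \<open>(1:1)\<close> and \<open>(1:-1)\<close> one coordinate is moved
  linearly, and at these two points, which the swap of coordinates fixes, a displacement
  \<open>t + \<i> t\<^sup>2\<close> is used, because for real \<open>t\<close> it determines \<open>t\<close> even up to sign.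

  That a generic member deforms only inside the family is an open condition on the third
  coordinates \<open>g i j\<close> of the products of \<open>e1\<close> and \<open>e2\<close>: the form \<open>g\<close> and its symmetric part are
  nondegenerate, and its skew part is nonzero. Under this condition there is a basis \<open>u1, u2\<close> of
  the plane \<open>\<langle>e1, e2\<rangle>\<close> that is isotropic for \<open>g\<close>, and \<open>u3 = u1 u2\<close> completes it to a basis of
  \<open>V\<close>. In such a basis associativity alone forces every remaining structure constant to vanish
  (\<open>assoc_product_eq_d22\<close>), so the product lies in the family (\<open>generic_in_family_d22\<close>).
  The coefficients of a deformation are continuous at \<open>0\<close>, hence the condition persists.

  Each jump deformation comes from vectors \<open>f t, g t, h t\<close> that form a basis of the target algebra for
  \<open>t \<noteq> 0\<close> and whose structure constants are polynomials in \<open>t\<close> that specialise at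
  \<open>t = 0\<close> to those of \<open>d22\<close> (\<open>jump_deformation_from_frames\<close>). The targets are not isomorphic to the undeformed
  product since all products of three factors vanish in \<open>d22\<close>, while each target has an
  element with nonzero cube.
\<close>

section \<open>Bilinear products and isomorphisms\<close>

lemma clinear_iff:
  "clinear f \<longleftrightarrow> (\<forall>u v. f (u + v) = f u + f v) \<and> (\<forall>c u. f (c *s u) = c *s f u)"
  by (simp add: Vector_Spaces.linear_iff vec.vector_space_axioms)

lemma cbilinear_iff:
  "cbilinear m \<longleftrightarrow>
     (\<forall>u v w. m (u + v) w = m u w + m v w) \<and> (\<forall>u v w. m u (v + w) = m u v + m u w) \<and>
     (\<forall>c u v. m (c *s u) v = c *s m u v) \<and> (\<forall>c u v. m u (c *s v) = c *s m u v)"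
  unfolding cbilinear_def clinear_iff by blast

definition scale :: "complex \<Rightarrow> product \<Rightarrow> product" where
  "scale c m = (\<lambda>u v. c *s m u v)"

lemma cbilinear_psi: "cbilinear (psi i j k)"
  by (auto simp: cbilinear_iff psi_def vec_eq_iff axis_def algebra_simps)

lemma cbilinear_add: "cbilinear m \<Longrightarrow> cbilinear n \<Longrightarrow> cbilinear (m + n)"
  by (auto simp: cbilinear_iff vector_add_ldistrib)

lemma cbilinear_scale: "cbilinear m \<Longrightarrow> cbilinear (scale c m)"
  by (auto simp: cbilinear_iff scale_def vector_add_ldistrib vector_smult_assoc mult.commute)

lemma cbilinear_zero: "cbilinear 0"
  by (auto simp: cbilinear_iff)

lemmas cbilinear_intros = cbilinear_add cbilinear_scale cbilinear_zero cbilinear_psi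

lemma d22_eq: "d22 x y = scale x (psi 1 2 3) + scale y (psi 2 1 3)"
  by (simp add: d22_def scale_def fun_eq_iff)

lemma d22_nth [simp]:
  "d22 x y u v $ 1 = 0" "d22 x y u v $ 2 = 0"
  "d22 x y u v $ 3 = x * (u $ 1 * v $ 2) + y * (u $ 2 * v $ 1)"
  by (simp_all add: d22_def psi_def axis_def)

lemma cbilinear_d22: "cbilinear (d22 x y)"
  unfolding d22_eq by (intro cbilinear_intros)

lemma assoc_product_d22: "assoc_product (d22 x y)"
  by (simp add: assoc_product_def cbilinear_d22 vec_eq_iff forall_3)

lemma basis_expansion: "(u :: V) = u $ 1 *s axis 1 1 + u $ 2 *s axis 2 1 + u $ 3 *s axis 3 1"
  by (simp add: vec_eq_iff forall_3 axis_def)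

lemma bij_of_trivial_kernel:
  assumes "clinear f" "\<And>u. f u = 0 \<Longrightarrow> u = 0"
  shows "bij f"
proof -
  have "u = v" if "f u = f v" for u v
  proof -
    have "f (u - v) + f v = f (u - v + v)"
      using assms(1) by (simp only: clinear_iff)
    then show ?thesis
      using assms(2)[of "u - v"] that by simp
  qed
  then have "inj f"
    by (rule injI)
  then show ?thesis
    using assms(1) vec.linear_inj_imp_surj bij_def by blast
qed

definition from_basis :: "V \<Rightarrow> V \<Rightarrow> V \<Rightarrow> V \<Rightarrow> V" where
  "from_basis f1 f2 f3 u = u $ 1 *s f1 + u $ 2 *s f2 + u $ 3 *s f3"

lemma clinear_from_basis: "clinear (from_basis f1 f2 f3)"
  by (simp add: clinear_iff from_basis_def vec_eq_iff algebra_simps)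

definition frame_det :: "V \<Rightarrow> V \<Rightarrow> V \<Rightarrow> complex" where
  "frame_det f g h = f $ 1 * (g $ 2 * h $ 3 - g $ 3 * h $ 2)
     - f $ 2 * (g $ 1 * h $ 3 - g $ 3 * h $ 1) + f $ 3 * (g $ 1 * h $ 2 - g $ 2 * h $ 1)"

text \<open>Cramer's rule.\<close>

lemma bij_from_basis:
  assumes "frame_det f g h \<noteq> 0"
  shows "bij (from_basis f g h)"
proof (rule bij_of_trivial_kernel[OF clinear_from_basis])
  fix u
  assume u: "from_basis f g h u = 0"
  have "frame_det f g h * u $ 1 = frame_det (from_basis f g h u) g h"
    "frame_det f g h * u $ 2 = frame_det f (from_basis f g h u) h"
    "frame_det f g h * u $ 3 = frame_det f g (from_basis f g h u)"
    by (simp_all add: frame_det_def from_basis_def algebra_simps)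
  then show "u = 0"
    unfolding u using assms by (simp add: frame_det_def vec_eq_iff forall_3)
qed

lemma clinear_inv:
  assumes "clinear f" "bij f"
  shows "clinear (inv f)"
proof -
  have f': "f (inv f u) = u" and inv_eq: "f u = v \<Longrightarrow> inv f v = u" for u v
    using assms(2) by (auto simp: bij_is_surj surj_f_inv_f bij_is_inj)
  have "f (inv f u + inv f v) = u + v" "f (c *s inv f u) = c *s u" for u v c
    using assms(1) by (simp_all add: clinear_iff f')
  then show ?thesis
    unfolding clinear_iff by (blast intro: inv_eq)
qed

lemma isomorphic_sym:
  assumes "m \<simeq> n"
  shows "n \<simeq> m"
proof -
  obtain f where f: "clinear f" "bij f" "\<And>u v. f (m u v) = n (f u) (f v)"
    using assms by (auto simp: isomorphic_def)
  have f': "f (inv f u) = u" and inv_eq: "f u = v \<Longrightarrow> inv f v = u" for u v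
    using f(2) by (auto simp: bij_is_surj surj_f_inv_f bij_is_inj)
  have "inv f (n u v) = m (inv f u) (inv f v)" for u v
    by (rule inv_eq) (simp add: f(3) f')
  then show ?thesis
    unfolding isomorphic_def using clinear_inv[OF f(1,2)] bij_imp_bij_inv[OF f(2)] by blast
qed

lemma assoc_product_pullback:
  assumes n: "assoc_product n" and f: "clinear f" "bij f"
    and hom: "\<And>u v. f (m u v) = n (f u) (f v)"
  shows "assoc_product m"
proof -
  have inj: "u = v" if "f u = f v" for u v
    using f(2) that by (meson bij_is_inj inj_eq)
  have f': "f (u + v) = f u + f v" "f (c *s u) = c *s f u" for u v c
    using f(1) by (simp_all add: clinear_iff)
  have n': "n (u + v) w = n u w + n v w" "n u (v + w) = n u v + n u w"
    "n (c *s u) v = c *s n u v" "n u (c *s v) = c *s n u v" "n (n u v) w = n u (n v w)" for c u v w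
    using n by (simp_all add: assoc_product_def cbilinear_iff)
  show ?thesis
    unfolding assoc_product_def cbilinear_iff by (intro conjI allI; rule inj) (simp_all add: hom f' n')
qed

section \<open>The isomorphism classes inside the family\<close>

lemma d22_swap: "d22 x y \<simeq> d22 y x"
proof -
  define f :: "V \<Rightarrow> V" where "f = (\<lambda>u. vector [u $ 2, u $ 1, u $ 3])"
  have lin: "clinear f"
    by (simp add: clinear_iff f_def vec_eq_iff forall_3)
  moreover have "bij f"
    by (rule bij_of_trivial_kernel[OF lin]) (simp add: f_def vec_eq_iff forall_3)
  moreover have "f (d22 x y u v) = d22 y x (f u) (f v)" for u v
    by (simp add: f_def vec_eq_iff forall_3)
  ultimately show ?thesis
    unfolding isomorphic_def by blast
qed

text \<open>
  An isomorphism \<open>f\<close> maps the line \<open>\<langle>e3\<rangle>\<close> of all products to itself, by a factor \<open>c\<close>, so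
  \<open>c G = G' (f u) (f v)\<close> for the associated forms. If \<open>\<delta>\<close> is the determinant of the map that \<open>f\<close>
  induces on the plane, the skew parts give \<open>c (x - y) = \<delta> (x' - y')\<close> and the determinants give
  \<open>c\<^sup>2 x y = \<delta>\<^sup>2 x' y'\<close>. Eliminating \<open>c\<close> and \<open>\<delta>\<close> leaves
  \<open>x' y' (x - y)\<^sup>2 = x y (x' - y')\<^sup>2\<close>, which factors as claimed.
\<close>

lemma d22_isomorphic_imp:
  assumes iso: "d22 x y \<simeq> d22 x' y'" and nz: "(x, y) \<noteq> (0, 0)"
  shows "x * x' = y * y' \<or> x * y' = x' * y"
proof -
  obtain f where f: "clinear f" "bij f" "\<And>u v. f (d22 x y u v) = d22 x' y' (f u) (f v)"
    using iso by (auto simp: isomorphic_def)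
  define G where "G x y u v = x * (u $ 1 * v $ 2) + y * (u $ 2 * v $ 1)" for x y and u v :: V
  have d22_G: "d22 x y u v = G x y u v *s axis 3 1" for x y u v
    by (simp add: vec_eq_iff forall_3 axis_def G_def)
  define c where "c = f (axis 3 1) $ 3"
  have smult: "f (a *s u) = a *s f u" for a u
    using f(1) by (simp add: clinear_iff)
  have G: "G x y u v *s f (axis 3 1) = G x' y' (f u) (f v) *s axis 3 1" for u v
    using f(3)[of u v] by (simp add: d22_G smult)
  have Gc: "c * G x y u v = G x' y' (f u) (f v)" for u v
    using arg_cong[OF G[of u v], of "\<lambda>w. w $ 3"] by (simp add: c_def mult.commute)
  have f0: "f 0 = 0"
    using smult[of 0 0] by simp
  have fne: "f (axis 3 1) \<noteq> 0"
    using f(2) f0 by (metis axis_eq_0_iff bij_is_inj inj_eq zero_neq_one)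
  obtain u v where uv: "G x y u v \<noteq> 0"
  proof (cases "x = 0")
    case True
    then show ?thesis
      using that[of "axis 2 1" "axis 1 1"] nz by (simp add: G_def axis_def)
  next
    case False
    then show ?thesis
      using that[of "axis 1 1" "axis 2 1"] by (simp add: G_def axis_def)
  qed
  have "f (axis 3 1) $ 1 = 0" "f (axis 3 1) $ 2 = 0"
    using arg_cong[OF G[of u v], of "\<lambda>w. w $ 1"] arg_cong[OF G[of u v], of "\<lambda>w. w $ 2"] uv
    by (simp_all add: axis_def)
  then have c: "c \<noteq> 0"
    using fne by (auto simp: c_def vec_eq_iff forall_3)
  define p q r s where "p = f (axis 1 1) $ 1" and "q = f (axis 1 1) $ 2"
    and "r = f (axis 2 1) $ 1" and "s = f (axis 2 1) $ 2"
  have e: "0 = x' * (p * q) + y' * (q * p)" "c * x = x' * (p * s) + y' * (q * r)"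
    "c * y = x' * (r * q) + y' * (s * p)" "0 = x' * (r * s) + y' * (s * r)"
    using Gc[of "axis 1 1" "axis 1 1"] Gc[of "axis 1 1" "axis 2 1"]
      Gc[of "axis 2 1" "axis 1 1"] Gc[of "axis 2 1" "axis 2 1"]
    by (simp_all add: G_def axis_def p_def q_def r_def s_def)
  define \<delta> where "\<delta> = p * s - q * r"
  have skew: "c * (x - y) = (x' - y') * \<delta>"
    using e(2,3) by (simp add: \<delta>_def algebra_simps)
  have det: "c^2 * (x * y) = x' * y' * \<delta>^2"
  proof -
    have "c^2 * (x * y) = (c * x) * (c * y) - 0 * 0"
      by (simp add: power2_eq_square)
    also have "\<dots> = (x' * (p * s) + y' * (q * r)) * (x' * (r * q) + y' * (s * p))
        - (x' * (p * q) + y' * (q * p)) * (x' * (r * s) + y' * (s * r))"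
      using e by metis
    also have "\<dots> = x' * y' * \<delta>^2"
      by (simp add: \<delta>_def power2_eq_square algebra_simps)
    finally show ?thesis .
  qed
  have \<delta>: "\<delta> \<noteq> 0"
    using skew det c nz by auto
  have "(c * \<delta>)^2 * ((x * x' - y * y') * (x * y' - x' * y)) = 0"
  proof -
    have "(c * \<delta>)^2 * ((x * x' - y * y') * (x * y' - x' * y)) =
        c^2 * (x' * y' * \<delta>^2) * (x - y)^2 - \<delta>^2 * (c^2 * (x * y)) * (x' - y')^2"
      by (simp add: power2_eq_square algebra_simps)
    also have "\<dots> = x' * y' * \<delta>^2 * ((c * (x - y))^2 - ((x' - y') * \<delta>)^2)"
      unfolding det by (simp add: power2_eq_square algebra_simps)
    finally show ?thesis
      by (simp add: skew)
  qed
  then show ?thesis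
    using c \<delta> by auto
qed

section \<open>Polynomial deformations\<close>

definition cubic_family :: "product \<Rightarrow> product \<Rightarrow> product \<Rightarrow> product \<Rightarrow> complex \<Rightarrow> product" where
  "cubic_family m \<psi>1 \<psi>2 \<psi>3 t = m + scale t \<psi>1 + scale (t^2) \<psi>2 + scale (t^3) \<psi>3"

lemma deformation_cubic_family:
  assumes bil: "cbilinear m" "cbilinear \<psi>1" "cbilinear \<psi>2" "cbilinear \<psi>3"
    and assoc: "\<And>t. assoc_product (cubic_family m \<psi>1 \<psi>2 \<psi>3 t)"
  shows "deformation m (cubic_family m \<psi>1 \<psi>2 \<psi>3)"
proof -
  define \<psi> :: "nat \<Rightarrow> product" where
    "\<psi> k = (if k = 0 then m else if k = 1 then \<psi>1 else if k = 2 then \<psi>2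
             else if k = 3 then \<psi>3 else 0)" for k
  have "(\<lambda>k. t^k *s \<psi> k u v) sums cubic_family m \<psi>1 \<psi>2 \<psi>3 t u v" for t u v
  proof -
    have "(\<lambda>k. t^k *s \<psi> k u v) sums (\<Sum>k<4. t^k *s \<psi> k u v)"
      by (rule sums_finite) (auto simp: \<psi>_def)
    also have "(\<Sum>k<4. t^k *s \<psi> k u v) = cubic_family m \<psi>1 \<psi>2 \<psi>3 t u v"
      by (simp add: \<psi>_def cubic_family_def scale_def eval_nat_numeral)
    finally show ?thesis .
  qed
  then show ?thesis
    unfolding deformation_def
    by (intro exI[of _ \<psi>]) (use bil assoc cbilinear_zero in \<open>auto simp: \<psi>_def\<close>)
qed

text \<open>
  Quadratic curves of parameters are general enough: degree one suffices where the swap of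
  coordinates does not fix the point, degree two where it does.
\<close>

lemma deforms_along_d22I:
  fixes x y x1 x2 y1 y2 :: complex
  assumes X: "\<And>t. X t = x + t * x1 + t^2 * x2" and Y: "\<And>t. Y t = y + t * y1 + t^2 * y2"
    and nz: "\<And>t. (X t, Y t) \<noteq> (0, 0)" and eps: "\<epsilon> > 0"
    and ne: "\<And>s t. s \<in> K \<Longrightarrow> t \<in> K \<Longrightarrow> norm s < \<epsilon> \<Longrightarrow> norm t < \<epsilon> \<Longrightarrow> s \<noteq> t \<Longrightarrow>
      X s * X t \<noteq> Y s * Y t \<and> X s * Y t \<noteq> X t * Y s"
  shows "deforms_along_d22 K (d22 x y)"
proof -
  have eq: "cubic_family (d22 x y) (d22 x1 y1) (d22 x2 y2) 0 = (\<lambda>t. d22 (X t) (Y t))"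
    by (simp add: fun_eq_iff vec_eq_iff forall_3 cubic_family_def scale_def X Y
        algebra_simps)
  have "deformation (d22 x y) (\<lambda>t. d22 (X t) (Y t))"
    unfolding eq[symmetric]
    by (rule deformation_cubic_family)
      (use fun_cong[OF eq] in \<open>simp_all add: cbilinear_d22 cbilinear_zero assoc_product_d22\<close>)
  moreover have "\<not> d22 (X s) (Y s) \<simeq> d22 (X t) (Y t)"
    if "s \<in> K" "t \<in> K" "norm s < \<epsilon>" "norm t < \<epsilon>" "s \<noteq> t" for s t
    using d22_isomorphic_imp[OF _ nz] ne[OF that] by blast
  ultimately have "smooth_deformation K (d22 x y) (\<lambda>t. d22 (X t) (Y t))"
    unfolding smooth_deformation_def using eps by blast
  moreover have "d22 (X t) (Y t) \<simeq> d22 (X t) (Y t)" for t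
    unfolding isomorphic_def by (rule exI[of _ "\<lambda>u. u"]) (simp add: clinear_iff bij_id[unfolded id_def])
  then have "in_family_d22 (d22 (X t) (Y t))" for t
    unfolding in_family_d22_def using nz by blast
  ultimately show ?thesis
    unfolding deforms_along_d22_def by (intro exI conjI) auto
qed

text \<open>
  Along \<open>(x : y + t)\<close> the parameters \<open>s \<noteq> t\<close> can only give isomorphic products when
  \<open>x\<^sup>2 = (y + s) (y + t)\<close>, which fails near \<open>s = t = 0\<close>.
\<close>

lemma deforms_along_d22_non_fixed:
  assumes "x \<noteq> 0" "x^2 \<noteq> y^2"
  shows "deforms_along_d22 UNIV (d22 x y)"
proof -
  define h where "h z = x^2 - (y + fst z) * (y + snd z)" for z :: "complex \<times> complex"
  have "isCont h (0, 0)"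
    unfolding h_def by (intro continuous_intros)
  moreover have "h (0, 0) \<noteq> 0"
    using assms(2) by (simp add: h_def power2_eq_square)
  ultimately obtain e where e: "e > 0" "\<And>z. dist (0, 0) z < e \<Longrightarrow> h z \<noteq> 0"
    using continuous_at_avoid by blast
  have "h (s, t) \<noteq> 0" if "norm s < e / 2" "norm t < e / 2" for s t
  proof (rule e(2))
    have "dist (0, 0) (s, t) \<le> norm s + norm t"
      by (simp add: dist_prod_def sqrt_sum_squares_le_sum)
    then show "dist (0, 0) (s, t) < e"
      using that by linarith
  qed
  then show ?thesis
    using assms e(1) deforms_along_d22I[of "\<lambda>t. x" x 0 0 "\<lambda>t. y + t" y 1 0 "e / 2" UNIV]
    by (auto simp: h_def power2_eq_square)
qed

text \<open>
  Real parts show that \<open>t\<close> is determined up to sign, and the imaginary part \<open>t\<^sup>2\<close>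
  would have to change sign with it.
\<close>

lemma real_parabola_inj_up_to_sign:
  assumes "s \<in> \<real>" "t \<in> \<real>" "s \<noteq> t"
  shows "s + \<i> * s^2 \<noteq> t + \<i> * t^2" "s + \<i> * s^2 + (t + \<i> * t^2) \<noteq> 0"
proof -
  obtain a b where ab: "s = complex_of_real a" "t = complex_of_real b"
    using assms by (auto elim!: Reals_cases)
  show "s + \<i> * s^2 \<noteq> t + \<i> * t^2"
    using assms(3) by (auto simp: ab complex_eq_iff power2_eq_square)
  show "s + \<i> * s^2 + (t + \<i> * t^2) \<noteq> 0"
    using assms(3) by (auto simp: ab complex_eq_iff power2_eq_square sum_squares_eq_zero_iff)
qed

text \<open>
  On the curve \<open>(1 + z : y (1 - z))\<close> the swap of coordinates is \<open>z \<mapsto> -z\<close>, so two members are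
  isomorphic only if their values of \<open>z\<close> agree up to sign.
\<close>

lemma deforms_along_d22_fixed:
  assumes "y = 1 \<or> y = -1"
  shows "deforms_along_d22 \<real> (d22 1 y)"
proof -
  have 1: "(1 + z) * (1 + w) - (y - y * z) * (y - y * w) = 2 * (z + w)"
    and 2: "(1 + z) * (y - y * w) - (1 + w) * (y - y * z) = 2 * y * (z - w)" for z w
    using assms by (auto simp: algebra_simps)
  have nz: "(1 + z, y - y * z) \<noteq> (0, 0)" for z
    using assms by auto
  define X Y :: "complex \<Rightarrow> complex"
    where "X t = 1 + t * 1 + t^2 * \<i>" and "Y t = y + t * (-y) + t^2 * (-(\<i> * y))" for t
  define z :: "complex \<Rightarrow> complex" where "z t = t + \<i> * t^2" for t
  have XY: "X t = 1 + z t" "Y t = y - y * z t" for t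
    by (simp_all add: X_def Y_def z_def algebra_simps)
  have "X s * X t \<noteq> Y s * Y t \<and> X s * Y t \<noteq> X t * Y s" if "s \<in> \<real>" "t \<in> \<real>" "s \<noteq> t" for s t
  proof -
    have "2 * (z s + z t) \<noteq> 0" "2 * y * (z s - z t) \<noteq> 0"
      using real_parabola_inj_up_to_sign[OF that] assms unfolding z_def mult_eq_0_iff by auto
    then show ?thesis
      unfolding XY 1[symmetric] 2[symmetric] by (simp only: right_minus_eq not_False_eq_True)
  qed
  moreover have "(X t, Y t) \<noteq> (0, 0)" for t
    unfolding XY by (rule nz)
  ultimately show ?thesis
    using deforms_along_d22I[OF X_def Y_def _ zero_less_one] by blast
qed

section \<open>Rigidity of the generic members\<close>

text \<open>
  Here \<open>E 1\<close> and \<open>E 2\<close> are isotropic, that is, their squares have no component along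
  \<open>E 3 = E 1 E 2\<close>. An element commutes with its own square; since \<open>E 1\<close> and \<open>E 2\<close> do not commute
  modulo \<open>\<langle>E 1, E 2\<rangle>\<close> (\<open>k \<noteq> 1\<close>), their squares are multiples of themselves:
  \<open>E 1 E 1 = a1 E 1\<close> and \<open>E 2 E 2 = b2 E 2\<close>. Then \<open>(E 2 E 1) E 1 = E 2 (E 1 E 1)\<close> relates \<open>c2\<close>
  to \<open>a1\<close> by a quadratic and a linear equation, whose only common solution is \<open>0\<close> because
  \<open>k\<close> is not \<open>0\<close>, \<open>1\<close> or \<open>-1\<close>; likewise for \<open>c1\<close> and \<open>b2\<close>.
\<close>

lemma assoc_product_eq_d22:
  fixes n :: product and a1 a2 b1 b2 c1 c2 k :: complex
  defines "E \<equiv> \<lambda>i. axis i 1 :: V"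
  assumes n: "assoc_product n"
    and n12: "n (E 1) (E 2) = E 3"
    and n11: "n (E 1) (E 1) = a1 *s E 1 + a2 *s E 2"
    and n22: "n (E 2) (E 2) = b1 *s E 1 + b2 *s E 2"
    and n21: "n (E 2) (E 1) = c1 *s E 1 + c2 *s E 2 + k *s E 3"
    and k: "k \<noteq> 0" "k \<noteq> 1" "k \<noteq> -1"
  shows "n = d22 1 k"
proof -
  have bil: "n (u + v) w = n u w + n v w" "n u (v + w) = n u v + n u w"
    "n (c *s u) v = c *s n u v" "n u (c *s v) = c *s n u v" for c u v w
    using n by (simp_all add: assoc_product_def cbilinear_iff)
  have assoc: "n (n u v) w = n u (n v w)" for u v w
    using n by (simp add: assoc_product_def)
  have n0: "n 0 u = 0" "n u 0 = 0" for u
    using bil(3)[of 0 0 u] bil(4)[of u 0 0] by simp_all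
  have E: "E i $ j = (if j = i then 1 else 0)" for i j
    by (simp add: E_def axis_def)
  note comp = vec_eq_iff forall_3 E

  have "n (n (E 1) (E 1)) (E 1) = n (E 1) (n (E 1) (E 1))"
    by (rule assoc)
  then have "a2 * k = a2"
    by (simp add: n11 n12 n21 bil comp)
  then have a2: "a2 = 0"
    using k by simp
  have "n (n (E 2) (E 2)) (E 2) = n (E 2) (n (E 2) (E 2))"
    by (rule assoc)
  then have "b1 = b1 * k"
    by (simp add: n22 n12 n21 bil comp)
  then have b1: "b1 = 0"
    using k by simp

  \<comment> \<open>Products with \<open>E 3\<close> are found by writing \<open>E 3 = E 1 E 2\<close>.\<close>
  have n13: "n (E 1) (E 3) = a1 *s E 3"
    using assoc[of "E 1" "E 1" "E 2"] by (simp add: n11 n12 bil a2)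
  have n32: "n (E 3) (E 2) = b2 *s E 3"
    using assoc[of "E 1" "E 2" "E 2"] by (simp add: n22 n12 bil b1)
  have n31: "n (E 3) (E 1) = (c1 * a1) *s E 1 + (c2 + k * a1) *s E 3"
    using assoc[of "E 1" "E 2" "E 1"] by (simp add: n11 n12 n21 n13 bil a2 comp)
  have n23: "n (E 2) (E 3) = (c2 * b2) *s E 2 + (c1 + k * b2) *s E 3"
    using assoc[of "E 2" "E 1" "E 2"] by (simp add: n22 n12 n21 n32 bil b1 comp)

  have "n (n (E 2) (E 1)) (E 1) = n (E 2) (n (E 1) (E 1))"
    by (rule assoc)
  then have A: "c2 * c2 = a1 * c2" "2 * (c2 * k) + k * (k * a1) = a1 * k"
    by (auto simp: n11 n21 n31 bil a2 comp algebra_simps)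
  have "k * (2 * c2 - a1 * (1 - k)) = 2 * (c2 * k) + k * (k * a1) - a1 * k"
    by (simp add: algebra_simps)
  then have "k * (2 * c2 - a1 * (1 - k)) = 0"
    unfolding A(2) by simp
  then have c2': "2 * c2 = a1 * (1 - k)"
    using k by simp
  have a1c2: "a1 = 0 \<and> c2 = 0"
  proof (cases "c2 = 0")
    case True
    then show ?thesis
      using c2' k by simp
  next
    case False
    then have "c2 = a1"
      using A(1) by simp
    moreover from this have "a1 * (1 + k) = 0"
      using c2' by (simp add: algebra_simps)
    ultimately show ?thesis
      using k by (simp add: add_eq_0_iff)
  qed
  have "n (n (E 2) (E 2)) (E 1) = n (E 2) (n (E 2) (E 1))"
    by (rule assoc)
  then have B: "b2 * c1 = c1 * c1" "2 * (c1 * k) + k * (k * b2) = b2 * k"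
    using a1c2 by (auto simp: n22 n21 n23 bil b1 comp distrib_left)
  have "k * (2 * c1 - b2 * (1 - k)) = 2 * (c1 * k) + k * (k * b2) - b2 * k"
    by (simp add: algebra_simps)
  then have "k * (2 * c1 - b2 * (1 - k)) = 0"
    unfolding B(2) by simp
  then have c1': "2 * c1 = b2 * (1 - k)"
    using k by simp
  have b2c1: "b2 = 0 \<and> c1 = 0"
  proof (cases "c1 = 0")
    case True
    then show ?thesis
      using c1' k by simp
  next
    case False
    then have "c1 = b2"
      using B(1) by simp
    moreover from this have "b2 * (1 + k) = 0"
      using c1' by (simp add: algebra_simps)
    ultimately show ?thesis
      using k by (simp add: add_eq_0_iff)
  qed
  have n33: "n (E 3) (E 3) = 0"
    using assoc[of "E 1" "E 2" "E 3"] a1c2 b2c1 by (simp add: n12 n23 n0)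
  show ?thesis
  proof (intro ext)
    fix u v
    have "n u v = n (u $ 1 *s E 1 + u $ 2 *s E 2 + u $ 3 *s E 3)
        (v $ 1 *s E 1 + v $ 2 *s E 2 + v $ 3 *s E 3)"
      unfolding E_def by (simp only: basis_expansion[symmetric])
    also have "\<dots> = d22 1 k u v"
      using a1c2 b2c1
      by (simp add: bil n11 n12 n21 n22 n13 n31 n23 n32 n33 a2 b1 comp)
    finally show "n u v = d22 1 k u v" .
  qed
qed

text \<open>
  The quadratic formula; for \<open>a = 0\<close> one of the two lines is the first coordinate axis.
\<close>

lemma two_isotropic_lines:
  fixes a b s :: complex
  assumes "s^2 \<noteq> 4 * a * b"
  obtains p q r z where "p * z - q * r \<noteq> 0"
    "a * p^2 + s * p * q + b * q^2 = 0" "a * r^2 + s * r * z + b * z^2 = 0"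
proof (cases "a = 0")
  case True
  then show ?thesis
    using assms that[of 1 s 0 "-b"] by (simp add: power2_eq_square)
next
  case False
  define d where "d = csqrt (s^2 - 4 * a * b)"
  have d: "d^2 = s^2 - 4 * a * b"
    by (simp add: d_def)
  then have "d \<noteq> 0"
    using assms by auto
  have root: "a * (-s + e)^2 + s * (-s + e) * (2 * a) + b * (2 * a)^2 = 0" if "e^2 = s^2 - 4 * a * b" for e
  proof -
    have "a * (-s + e)^2 + s * (-s + e) * (2 * a) + b * (2 * a)^2 = a * (e^2 - (s^2 - 4 * a * b))"
      by (simp add: power2_eq_square algebra_simps)
    also have "\<dots> = 0"
      unfolding that by simp
    finally show ?thesis .
  qed
  have "(-s + d) * (2 * a) - 2 * a * (-s + -d) = 4 * a * d"
    by (simp add: algebra_simps)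
  then have "(-s + d) * (2 * a) - 2 * a * (-s + -d) \<noteq> 0"
    using False \<open>d \<noteq> 0\<close> by simp
  moreover have "(-d)^2 = s^2 - 4 * a * b"
    using d by simp
  ultimately show ?thesis
    using that root d by blast
qed

text \<open>
  The hypotheses say that the form with matrix \<open>g\<close> is nondegenerate, not symmetric, and has a
  nondegenerate symmetric part. In an isotropic basis the matrix becomes \<open>((0, x), (y, 0))\<close>, and
  the hypotheses become \<open>x y \<noteq> 0\<close>, \<open>x \<noteq> y\<close> and \<open>x \<noteq> - y\<close>, because each of the three
  quantities is an invariant up to a power of the determinant of the base change.
\<close>

lemma generic_in_family_d22:
  fixes m :: product
  defines "g \<equiv> \<lambda>i j. m (axis i 1) (axis j 1) $ 3"
  assumes m: "assoc_product m"
    and det: "g 1 1 * g 2 2 \<noteq> g 1 2 * g 2 1" and skew: "g 1 2 \<noteq> g 2 1"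
    and sym: "(g 1 2 + g 2 1)^2 \<noteq> 4 * g 1 1 * g 2 2"
  shows "in_family_d22 m"
proof -
  have bil: "m (u + v) w = m u w + m v w" "m u (v + w) = m u v + m u w"
    "m (c *s u) v = c *s m u v" "m u (c *s v) = c *s m u v" for c u v w
    using m by (simp_all add: assoc_product_def cbilinear_iff)
  obtain p q r s where pqrs: "p * s - q * r \<noteq> 0"
    "g 1 1 * p^2 + (g 1 2 + g 2 1) * p * q + g 2 2 * q^2 = 0"
    "g 1 1 * r^2 + (g 1 2 + g 2 1) * r * s + g 2 2 * s^2 = 0"
    using two_isotropic_lines[OF sym] by metis
  define u1 u2 :: V where "u1 = p *s axis 1 1 + q *s axis 2 1" and "u2 = r *s axis 1 1 + s *s axis 2 1"
  define u3 where "u3 = m u1 u2"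
  have u11: "m u1 u1 $ 3 = 0" and u22: "m u2 u2 $ 3 = 0"
    using pqrs(2,3) by (simp_all add: u1_def u2_def bil g_def power2_eq_square algebra_simps)
  define x y where "x = m u1 u2 $ 3" and "y = m u2 u1 $ 3"
  have x: "x = g 1 1 * p * r + g 1 2 * p * s + g 2 1 * q * r + g 2 2 * q * s"
    and y: "y = g 1 1 * p * r + g 1 2 * q * r + g 2 1 * p * s + g 2 2 * q * s"
    by (simp_all add: x_def y_def u1_def u2_def bil g_def algebra_simps)
  have "x - y = (g 1 2 - g 2 1) * (p * s - q * r)"
    by (simp add: x y algebra_simps)
  then have xy: "x \<noteq> y"
    using skew pqrs(1) by auto
  \<comment> \<open>Subtracting the product of the two vanishing values of the quadratic form turns \<open>x * y\<close>
    into minus the determinant of \<open>g\<close> in the new basis.\<close>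
  have xy0: "x * y \<noteq> 0"
  proof -
    have "x * y = x * y - (g 1 1 * p^2 + (g 1 2 + g 2 1) * p * q + g 2 2 * q^2)
        * (g 1 1 * r^2 + (g 1 2 + g 2 1) * r * s + g 2 2 * s^2)"
      using pqrs by simp
    also have "\<dots> = (g 1 2 * g 2 1 - g 1 1 * g 2 2) * (p * s - q * r)^2"
      unfolding x y by (simp add: power2_eq_square algebra_simps)
    finally show ?thesis
      using det pqrs(1) by simp
  qed
  have xy': "x \<noteq> - y"
  proof -
    have "(x + y)^2 = (x + y)^2 - 4 * (g 1 1 * p^2 + (g 1 2 + g 2 1) * p * q + g 2 2 * q^2)
        * (g 1 1 * r^2 + (g 1 2 + g 2 1) * r * s + g 2 2 * s^2)"
      using pqrs by simp
    also have "\<dots> = ((g 1 2 + g 2 1)^2 - 4 * g 1 1 * g 2 2) * (p * s - q * r)^2"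
      unfolding x y by (simp add: power2_eq_square algebra_simps)
    finally have e: "(x + y)^2 = ((g 1 2 + g 2 1)^2 - 4 * g 1 1 * g 2 2) * (p * s - q * r)^2" .
    have "(x + y)^2 \<noteq> 0"
      unfolding e using sym pqrs(1) by simp
    then show ?thesis
      by auto
  qed

  define F where "F = from_basis u1 u2 u3"
  have lin: "clinear F"
    unfolding F_def by (rule clinear_from_basis)
  have F3: "F w $ 3 = w $ 3 * x" for w
    by (simp add: F_def from_basis_def u1_def u2_def u3_def x_def axis_def)
  have "frame_det u1 u2 u3 = (p * s - q * r) * x"
    by (simp add: frame_det_def u1_def u2_def u3_def x_def axis_def algebra_simps)
  then have bij: "bij F"
    unfolding F_def using pqrs(1) xy0 by (intro bij_from_basis) simp
  \<comment> \<open>The product of \<open>m\<close> in coordinates with respect to \<open>u1, u2, u3\<close>.\<close>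
  define n where "n u v = inv F (m (F u) (F v))" for u v
  have FF: "F (inv F w) = w" for w
    using bij by (simp add: bij_is_surj surj_f_inv_f)
  have hom: "F (n u v) = m (F u) (F v)" for u v
    by (simp add: n_def FF)
  have n: "assoc_product n"
    using assoc_product_pullback[OF m lin bij, of n] hom by blast
  have FE: "F (axis 1 1) = u1" "F (axis 2 1) = u2" "F (axis 3 1) = u3"
    by (simp_all add: F_def from_basis_def axis_def)
  have n3: "n u v $ 3 = m (F u) (F v) $ 3 / x" for u v
    using F3[of "n u v"] xy0 by (simp add: hom)
  have expand: "w = w $ 1 *s axis 1 1 + w $ 2 *s axis 2 1" if "w $ 3 = 0" for w :: V
    using basis_expansion[of w] that by simp
  have "inv F (F w) = w" for w
    using bij by (simp add: bij_is_inj)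
  then have "n (axis 1 1) (axis 2 1) = axis 3 1"
    unfolding n_def FE using u3_def FE(3) by metis
  moreover have "n (axis 2 1) (axis 1 1) $ 3 = y / x"
    by (simp add: n3 FE y_def)
  moreover have "y / x \<noteq> 0" "y / x \<noteq> 1" "y / x \<noteq> -1"
    using xy0 xy xy' by (auto simp: divide_eq_eq)
  ultimately have "n = d22 1 (y / x)"
    using assoc_product_eq_d22[OF n _ expand expand] basis_expansion[of "n (axis 2 1) (axis 1 1)"]
    by (simp add: n3 FE u11 u22)
  then have "d22 1 (y / x) \<simeq> m"
    unfolding isomorphic_def using lin bij hom by blast
  from isomorphic_sym[OF this] show ?thesis
    unfolding in_family_d22_def by (intro exI[of _ 1] exI[of _ "y / x"]) simp
qed

lemma deformation_tendsto:
  assumes "deformation m D"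
  shows "((\<lambda>t. D t u v $ i) \<longlongrightarrow> m u v $ i) (nhds 0)"
proof -
  obtain \<psi> where \<psi>0: "\<psi> 0 = m"
    and ev: "\<forall>\<^sub>F t in nhds 0. (\<forall>u v. (\<lambda>k. t ^ k *s \<psi> k u v) sums D t u v) \<and> assoc_product (D t)"
    using assms unfolding deformation_def by (elim exE conjE)
  obtain e where e: "e > 0" and D: "\<And>t u v. norm t < e \<Longrightarrow> (\<lambda>k. t ^ k *s \<psi> k u v) sums D t u v"
    using ev unfolding eventually_nhds_metric by (auto simp: dist_norm)
  have sums: "(\<lambda>k. \<psi> k u v $ i * t ^ k) sums (D t u v $ i)" if "norm t < e" for t
    using bounded_linear.sums[OF bounded_linear_vec_nth[of i] D[OF that]]
    by (simp add: mult.commute)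
  have "((\<lambda>t. D t u v $ i) \<longlongrightarrow> \<psi> 0 u v $ i) (at 0)"
    by (rule powser_limit_0[OF e, where a = "\<lambda>k. \<psi> k u v $ i"]) (rule sums)
  moreover have "D 0 u v $ i = \<psi> 0 u v $ i"
    using sums_unique2[OF sums[of 0] powser_sums_zero] e by simp
  ultimately show ?thesis
    by (simp add: tendsto_nhds_iff \<psi>0)
qed

lemma deformation_in_family_d22:
  assumes D: "deformation (d22 x y) D" and xy: "x \<noteq> 0" "y \<noteq> 0" "x \<noteq> y" "x \<noteq> - y"
  shows "\<forall>\<^sub>F t in nhds 0. in_family_d22 (D t)"
proof -
  define g where "g t i j = D t (axis i 1) (axis j 1) $ 3" for t and i j :: 3
  have lim: "((\<lambda>t. g t i j) \<longlongrightarrow> d22 x y (axis i 1) (axis j 1) $ 3) (nhds 0)" for i j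
    unfolding g_def by (rule deformation_tendsto[OF D])
  have g11: "((\<lambda>t. g t 1 1) \<longlongrightarrow> 0) (nhds 0)" and g12: "((\<lambda>t. g t 1 2) \<longlongrightarrow> x) (nhds 0)"
    and g21: "((\<lambda>t. g t 2 1) \<longlongrightarrow> y) (nhds 0)" and g22: "((\<lambda>t. g t 2 2) \<longlongrightarrow> 0) (nhds 0)"
    using lim[of 1 1] lim[of 1 2] lim[of 2 1] lim[of 2 2] by (simp_all add: axis_def)
  have "x + y \<noteq> 0"
    using xy(4) by (simp add: add_eq_0_iff2)
  have 1: "\<forall>\<^sub>F t in nhds 0. g t 1 1 * g t 2 2 - g t 1 2 * g t 2 1 \<noteq> 0"
    by (rule tendsto_imp_eventually_ne[OF tendsto_diff[OF tendsto_mult[OF g11 g22] tendsto_mult[OF g12 g21]]])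
      (use xy in simp)
  have 2: "\<forall>\<^sub>F t in nhds 0. g t 1 2 - g t 2 1 \<noteq> 0"
    by (rule tendsto_imp_eventually_ne[OF tendsto_diff[OF g12 g21]]) (use xy in simp)
  have 3: "\<forall>\<^sub>F t in nhds 0. (g t 1 2 + g t 2 1)^2 - 4 * (g t 1 1 * g t 2 2) \<noteq> 0"
    by (rule tendsto_imp_eventually_ne[OF tendsto_diff[OF
          tendsto_power[OF tendsto_add[OF g12 g21]] tendsto_mult[OF tendsto_const tendsto_mult[OF g11 g22]]]])
      (use \<open>x + y \<noteq> 0\<close> in simp)
  have "\<forall>\<^sub>F t in nhds 0. assoc_product (D t)"
    using D unfolding deformation_def by (auto elim: eventually_mono)
  with 1 2 3 show ?thesis
  proof eventually_elim
    case (elim t)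
    then show ?case
      by (intro generic_in_family_d22) (simp_all add: g_def mult.assoc)
  qed
qed

section \<open>Jump deformations\<close>

text \<open>
  The family is transported from \<open>m'\<close> by the basis \<open>f t, g t, h t\<close>, which makes it associative
  and isomorphic to \<open>m'\<close> for \<open>t \<noteq> 0\<close>. At \<open>t = 0\<close> the basis degenerates, but the product there is
  \<open>d22 x y\<close>. The element \<open>e\<close> witnesses that \<open>m'\<close> is not isomorphic to \<open>d22 x y\<close>.
\<close>

lemma jump_deformation_from_frames:
  fixes f g h :: "complex \<Rightarrow> V"
  defines "F \<equiv> \<lambda>t. from_basis (f t) (g t) (h t)"
  assumes bil: "cbilinear A" "cbilinear B" "cbilinear C"
    and m': "assoc_product m'"
    and det: "\<And>t. t \<noteq> 0 \<Longrightarrow> frame_det (f t) (g t) (h t) \<noteq> 0"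
    and hom: "\<And>t u v. F t (cubic_family (d22 x y) A B C t u v) = m' (F t u) (F t v)"
    and cube: "m' (m' e e) e \<noteq> 0"
  shows "has_jump_deformation (d22 x y) m'"
proof -
  define D where "D = cubic_family (d22 x y) A B C"
  have lin: "clinear (F t)" for t
    unfolding F_def by (rule clinear_from_basis)
  have bij: "bij (F t)" if "t \<noteq> 0" for t
    unfolding F_def by (rule bij_from_basis[OF det[OF that]])
  have iso: "D t \<simeq> m'" if "t \<noteq> 0" for t
    unfolding isomorphic_def D_def using lin bij[OF that] hom by blast
  have "assoc_product (D t)" for t
  proof (cases "t = 0")
    case True
    then have "D t = d22 x y"
      by (simp add: D_def cubic_family_def scale_def fun_eq_iff)
    then show ?thesis
      by (simp add: assoc_product_d22)
  next
    case False
    then show ?thesis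
      unfolding D_def using assoc_product_pullback[OF m' lin bij] hom by blast
  qed
  then have "deformation (d22 x y) D"
    unfolding D_def by (intro deformation_cubic_family cbilinear_d22 bil)
  moreover have "\<forall>\<^sub>F t in at 0. D t \<simeq> m'"
    using iso by (simp add: eventually_at_filter)
  moreover have "\<not> d22 x y \<simeq> m'"
  proof
    assume "d22 x y \<simeq> m'"
    then obtain k where k: "clinear k" "bij k" "\<And>u v. k (d22 x y u v) = m' (k u) (k v)"
      by (auto simp: isomorphic_def)
    obtain u where "e = k u"
      using k(2) by (meson bij_is_surj surjE)
    then have "m' (m' e e) e = k (d22 x y (d22 x y u u) u)"
      by (simp add: k(3))
    \<comment> \<open>Zero is written as a multiple so that linearity of \<open>k\<close> applies directly.\<close>
    also have "d22 x y (d22 x y u u) u = 0 *s u"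
      by (simp add: vec_eq_iff forall_3)
    also have "k (0 *s u) = 0"
      using k(1) by (simp only: clinear_iff) simp
    finally show False
      using cube by simp
  qed
  ultimately show ?thesis
    unfolding has_jump_deformation_def by blast
qed

lemma psi_nth [simp]: "psi i j k u v $ l = (if l = k then u $ i * v $ j else 0)"
  by (simp add: psi_def axis_def)

lemma assoc_products:
  "assoc_product d2" "assoc_product d3" "assoc_product d4" "assoc_product d5" "assoc_product d6"
  "assoc_product d7" "assoc_product d9" "assoc_product d10" "assoc_product d11"
  "assoc_product d12" "assoc_product d13" "assoc_product d14" "assoc_product d16"
  "assoc_product d17" "assoc_product d19"
  unfolding assoc_product_def d2_def d3_def d4_def d5_def d6_def d7_def d9_def d10_def d11_def
    d12_def d13_def d14_def d16_def d17_def d19_def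
  by (intro conjI cbilinear_intros; simp add: vec_eq_iff forall_3 algebra_simps)+

lemmas frame_simps = frame_det_def from_basis_def cubic_family_def scale_def
  vec_eq_iff forall_3 power2_eq_square power3_eq_cube

text \<open>
  If \<open>e\<close> is idempotent, then \<open>(t e) (t e) = t (t e)\<close>, so multiples \<open>t e\<close> have square zero in the limit.
  In \<open>d3\<close>, \<open>d9\<close>, \<open>d11\<close> and \<open>d13\<close> the basis starts with \<open>f = t e\<close> for an idempotent \<open>e\<close>, and \<open>g\<close> is
  chosen such that \<open>e g\<close> is not proportional to \<open>g\<close> while \<open>g e\<close> is \<open>0\<close> or \<open>g\<close>. Then \<open>h = f g\<close> is a
  new basis vector and \<open>g f\<close> is \<open>0\<close> or \<open>t g\<close>. In \<open>d4\<close>, \<open>d10\<close> and \<open>d17\<close> the roles of \<open>f\<close> and \<open>g\<close> are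
  exchanged; in \<open>d17\<close> the idempotent is \<open>e1 - e2\<close>. In \<open>d10\<close>,
  \<open>d11\<close> and \<open>d13\<close> a second idempotent is needed to complete the basis. In \<open>d10\<close> and \<open>d11\<close>, where
  \<open>h\<close> has order \<open>t\<close>, a multiple of it by \<open>c\<close> contributes \<open>- (c / t) h\<close> to the square of the
  basis vector, whence the choice \<open>c = t\<^sup>2\<close>.
\<close>

lemma jump_d3: "has_jump_deformation (d22 1 0) d3"
  by (rule jump_deformation_from_frames[where e = "axis 1 1"
      and f = "\<lambda>t. vector [t, 0, 0]" and g = "\<lambda>t. vector [0, 1, 1]"
      and h = "\<lambda>t. vector [0, 0, t]"
      and A = "psi 1 1 1 + psi 1 3 3"
      and B = "0" and C = "0"])
    (intro cbilinear_intros assoc_products | simp add: d3_def frame_simps axis_def algebra_simps)+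

lemma jump_d4: "has_jump_deformation (d22 1 0) d4"
  by (rule jump_deformation_from_frames[where e = "axis 1 1"
      and f = "\<lambda>t. vector [0, 1, 1]" and g = "\<lambda>t. vector [t, 0, 0]"
      and h = "\<lambda>t. vector [0, 0, t]"
      and A = "psi 2 2 2 + psi 3 2 3"
      and B = "0" and C = "0"])
    (intro cbilinear_intros assoc_products | simp add: d4_def frame_simps axis_def algebra_simps)+

lemma jump_d9: "has_jump_deformation (d22 1 0) d9"
  by (rule jump_deformation_from_frames[where e = "axis 1 1"
      and f = "\<lambda>t. vector [t, 0, 0]" and g = "\<lambda>t. vector [0, 1, 1]"
      and h = "\<lambda>t. vector [0, 0, t]"
      and A = "psi 1 1 1 + psi 2 1 2 + psi 1 3 3 + psi 3 1 3"
      and B = "0" and C = "0"])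
    (intro cbilinear_intros assoc_products | simp add: d9_def frame_simps axis_def algebra_simps)+

lemma jump_d10: "has_jump_deformation (d22 1 0) d10"
  by (rule jump_deformation_from_frames[where e = "axis 1 1"
      and f = "\<lambda>t. vector [0, 1, t^2]" and g = "\<lambda>t. vector [t, 0, 0]"
      and h = "\<lambda>t. vector [0, t, 0]"
      and A = "psi 2 2 2 + psi 3 2 3 + scale (-1) (psi 1 1 3)"
      and B = "psi 1 1 1" and C = "0"])
    (intro cbilinear_intros assoc_products | simp add: d10_def frame_simps axis_def algebra_simps)+

lemma jump_d11: "has_jump_deformation (d22 1 0) d11"
  by (rule jump_deformation_from_frames[where e = "axis 1 1"
      and f = "\<lambda>t. vector [0, t, 0]" and g = "\<lambda>t. vector [t^2, 0, 1]"
      and h = "\<lambda>t. vector [0, 0, t]"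
      and A = "psi 1 1 1 + psi 1 3 3 + scale (-1) (psi 2 2 3)"
      and B = "psi 2 2 2" and C = "0"])
    (intro cbilinear_intros assoc_products | simp add: d11_def frame_simps axis_def algebra_simps)+

lemma jump_d13: "has_jump_deformation (d22 1 0) d13"
  by (rule jump_deformation_from_frames[where e = "axis 1 1"
      and f = "\<lambda>t. vector [0, t, 0]" and g = "\<lambda>t. vector [t^2, 0, 1]"
      and h = "\<lambda>t. vector [0, 0, t]"
      and A = "psi 1 1 1 + psi 1 3 3"
      and B = "psi 2 2 2 + psi 3 2 3" and C = "0"])
    (intro cbilinear_intros assoc_products | simp add: d13_def frame_simps axis_def algebra_simps)+

lemma jump_d17: "has_jump_deformation (d22 1 0) d17"
  by (rule jump_deformation_from_frames[where e = "axis 1 1"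
      and f = "\<lambda>t. vector [0, 1, 1]" and g = "\<lambda>t. vector [t, -t, 0]"
      and h = "\<lambda>t. vector [0, t, 0]"
      and A = "psi 2 1 1 + psi 2 2 2 + psi 2 3 3 + psi 3 2 3"
      and B = "0" and C = "0"])
    (intro cbilinear_intros assoc_products | simp add: d17_def frame_simps axis_def algebra_simps)+

text \<open>
  Over \<open>(1:1)\<close> the targets are commutative. In \<open>d2\<close>, \<open>d6\<close>, \<open>d14\<close> and \<open>d19\<close> the form is first
  diagonalised: there are \<open>p\<close>, \<open>q\<close> and \<open>h\<close> such that, up to terms with coefficients divisible by \<open>t\<close>,
  \<open>p p = h\<close>, \<open>q q = - h\<close> and \<open>p q = 0\<close>, and \<open>f = p + q\<close>, \<open>g = (p - q) / 2\<close> is the isotropic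
  basis. For \<open>d2\<close> these are \<open>p = t e2\<close>, \<open>q = t (e1 + e3)\<close>, \<open>h = t\<^sup>2 e3\<close>.
\<close>

lemma jump_d2: "has_jump_deformation (d22 1 1) d2"
  by (rule jump_deformation_from_frames[where e = "axis 1 1"
      and f = "\<lambda>t. vector [t, t, t]" and g = "\<lambda>t. vector [-t/2, t/2, -t/2]"
      and h = "\<lambda>t. vector [0, 0, t^2]"
      and A = "scale (1/2) (psi 1 1 1) + scale (-1/4) (psi 1 2 1)
        + scale (-1/4) (psi 2 1 1) + scale (1/8) (psi 2 2 1)
        + scale (-1) (psi 1 1 2) + scale (1/2) (psi 1 2 2)
        + scale (1/2) (psi 2 1 2) + scale (-1/4) (psi 2 2 2)"
      and B = "0" and C = "0"])
    (intro cbilinear_intros assoc_products | simp add: d2_def frame_simps axis_def algebra_simps)+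

text \<open>
  Here, and for \<open>d12\<close>, \<open>f\<close> is \<open>t e\<close> with an idempotent \<open>e\<close>, and \<open>e g = g e\<close> is not
  proportional to \<open>g\<close>, so that \<open>h = f g = g f\<close>. The second idempotent in \<open>d12\<close> has the coefficient
  \<open>t\<^sup>2\<close> for the same reason as in \<open>d11\<close>.
\<close>

lemma jump_d5: "has_jump_deformation (d22 1 1) d5"
  by (rule jump_deformation_from_frames[where e = "axis 1 1"
      and f = "\<lambda>t. vector [t, 0, 0]" and g = "\<lambda>t. vector [0, 1, 1]"
      and h = "\<lambda>t. vector [0, 0, t]"
      and A = "psi 1 1 1 + psi 1 3 3 + psi 3 1 3"
      and B = "0" and C = "0"])
    (intro cbilinear_intros assoc_products | simp add: d5_def frame_simps axis_def algebra_simps)+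

text \<open>Diagonal basis: \<open>p = t (e1 - e2)\<close>, \<open>q = t (e3 + e2)\<close>, \<open>h = t\<^sup>2 e2\<close>.\<close>

lemma jump_d6: "has_jump_deformation (d22 1 1) d6"
  by (rule jump_deformation_from_frames[where e = "axis 1 1"
      and f = "\<lambda>t. vector [t, 0, t]" and g = "\<lambda>t. vector [t/2, -t, -t/2]"
      and h = "\<lambda>t. vector [0, t^2, 0]"
      and A = "psi 1 1 1 + psi 1 2 2 + psi 2 1 2 + scale (1/4) (psi 2 2 1)"
      and B = "0" and C = "0"])
    (intro cbilinear_intros assoc_products | simp add: d6_def frame_simps axis_def algebra_simps)+

lemma jump_d12: "has_jump_deformation (d22 1 1) d12"
  by (rule jump_deformation_from_frames[where e = "axis 1 1"
      and f = "\<lambda>t. vector [0, t, 0]" and g = "\<lambda>t. vector [t^2, 0, 1]"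
      and h = "\<lambda>t. vector [0, 0, t]"
      and A = "psi 1 1 1 + scale (-1) (psi 2 2 3) + psi 1 3 3 + psi 3 1 3"
      and B = "psi 2 2 2" and C = "0"])
    (intro cbilinear_intros assoc_products | simp add: d12_def frame_simps axis_def algebra_simps)+

text \<open>
  The basis of the case \<open>d6\<close> with \<open>e2\<close>, which has square zero there and is idempotent here, replaced by
  \<open>t e2\<close>: \<open>p = t (e1 - t e2)\<close>, \<open>q = t (e3 + t e2)\<close>, \<open>h = t\<^sup>3 e2\<close>.
\<close>

lemma jump_d14: "has_jump_deformation (d22 1 1) d14"
  by (rule jump_deformation_from_frames[where e = "axis 1 1"
      and f = "\<lambda>t. vector [t, 0, t]" and g = "\<lambda>t. vector [t/2, -(t^2), -t/2]"
      and h = "\<lambda>t. vector [0, t^3, 0]"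
      and A = "psi 1 1 1 + psi 1 2 2 + psi 2 1 2 + scale (1/4) (psi 2 2 1) + psi 2 2 3"
      and B = "scale (-1) (psi 2 3 3) + scale (-1) (psi 3 2 3)" and C = "psi 3 3 3"])
    (intro cbilinear_intros assoc_products | simp add: d14_def frame_simps axis_def algebra_simps)+

text \<open>
  The algebra is spanned by \<open>X = e1\<close>, \<open>X\<^sup>2 = e2\<close> and \<open>X\<^sup>3 = e3\<close> with \<open>X\<^sup>4 = 0\<close>. Scaling \<open>X\<close> and \<open>X\<^sup>3\<close>
  by \<open>t\<close> keeps \<open>X X\<^sup>2 = X\<^sup>3\<close> and turns \<open>X X = X\<^sup>2\<close> into a term of order \<open>t\<^sup>2\<close>.
\<close>

lemma jump_d16: "has_jump_deformation (d22 1 1) d16"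
  by (rule jump_deformation_from_frames[where e = "axis 1 1"
      and f = "\<lambda>t. vector [t, 0, 0]" and g = "\<lambda>t. vector [0, 1, 0]"
      and h = "\<lambda>t. vector [0, 0, t]"
      and A = "0"
      and B = "psi 1 1 2" and C = "0"])
    (intro cbilinear_intros assoc_products | simp add: d16_def frame_simps axis_def algebra_simps)+

text \<open>
  Diagonal basis: \<open>p = t e1\<close>, \<open>q = t (e3 - e2)\<close>, \<open>h = t\<^sup>2 e2\<close>. As \<open>e1\<close> and \<open>e2\<close> are
  nilpotent, the element with nonzero cube is the unit \<open>e3\<close>.
\<close>

lemma jump_d19: "has_jump_deformation (d22 1 1) d19"
  by (rule jump_deformation_from_frames[where e = "axis 3 1"
      and f = "\<lambda>t. vector [t, -t, t]" and g = "\<lambda>t. vector [t/2, t/2, -t/2]"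
      and h = "\<lambda>t. vector [0, t^2, 0]"
      and A = "scale (3/2) (psi 1 1 1) + psi 1 1 2 + scale (-1/4) (psi 1 2 1)
        + scale (1/2) (psi 1 2 2) + scale (-1/4) (psi 2 1 1)
        + scale (1/2) (psi 2 1 2) + scale (-1/8) (psi 2 2 1)
        + scale (-3/4) (psi 2 2 2) + psi 1 3 3 + psi 3 1 3
        + scale (-1/2) (psi 2 3 3) + scale (-1/2) (psi 3 2 3)"
      and B = "0" and C = "0"])
    (intro cbilinear_intros assoc_products | simp add: d19_def frame_simps axis_def algebra_simps)+

text \<open>
  The idempotent \<open>e1\<close> splits \<open>g = e2 + e3\<close> as \<open>g = g e1 + e1 g\<close>, which gives
  \<open>g f = t g - f g\<close> and hence the sign of \<open>(1:-1)\<close> in the limit.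
\<close>

lemma jump_d7: "has_jump_deformation (d22 1 (-1)) d7"
  by (rule jump_deformation_from_frames[where e = "axis 1 1"
      and f = "\<lambda>t. vector [t, 0, 0]" and g = "\<lambda>t. vector [0, 1, 1]"
      and h = "\<lambda>t. vector [0, 0, t]"
      and A = "psi 1 1 1 + psi 2 1 2 + psi 1 3 3"
      and B = "0" and C = "0"])
    (intro cbilinear_intros assoc_products | simp add: d7_def frame_simps axis_def algebra_simps)+

section \<open>The deformations of the family\<close>

lemma not_proj_eq_special:
  assumes nz: "(x, y) \<noteq> (0, 0)"
    and np: "\<forall>p \<in> {(1, 0), (0, 1), (1, 1), (1, -1)}. \<not> proj_eq (x, y) p"
  shows "x \<noteq> 0" "y \<noteq> 0" "x \<noteq> y" "x \<noteq> - y"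
proof -
  have 0: "c = 0 \<or> (1, 0) \<noteq> (c * x, c * y)" "c = 0 \<or> (0, 1) \<noteq> (c * x, c * y)"
    "c = 0 \<or> (1, 1) \<noteq> (c * x, c * y)" "c = 0 \<or> (1, -1) \<noteq> (c * x, c * y)" for c
    using np by (auto simp: proj_eq_def)
  show "x \<noteq> 0" using nz 0(2)[of "1 / y"] by auto
  then show "y \<noteq> 0" "x \<noteq> y" "x \<noteq> - y"
    using 0(1,3,4)[of "1 / x"] by (auto simp: field_simps)
qed

theorem mainTheorem5:
  shows "(\<forall>x y. (x, y) \<noteq> (0, 0) \<longrightarrow> d22 x y \<simeq> d22 y x) \<and>
    (\<forall>x y. (x, y) \<noteq> (0, 0) \<longrightarrow>
       (\<forall>p \<in> {(1, 0), (0, 1), (1, 1), (1, -1)}. \<not> proj_eq (x, y) p) \<longrightarrow>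
       (\<forall>D. deformation (d22 x y) D \<longrightarrow> (\<forall>\<^sub>F t in nhds 0. in_family_d22 (D t))) \<and>
       deforms_along_d22 UNIV (d22 x y)) \<and>
    ((\<forall>m \<in> {d3, d4, d9, d10, d11, d13, d17}. has_jump_deformation (d22 1 0) m) \<and>
       deforms_along_d22 UNIV (d22 1 0)) \<and>
    ((\<forall>m \<in> {d2, d5, d6, d12, d14, d16, d19}. has_jump_deformation (d22 1 1) m) \<and>
       deforms_along_d22 \<real> (d22 1 1)) \<and>
    (has_jump_deformation (d22 1 (-1)) d7 \<and> deforms_along_d22 \<real> (d22 1 (-1)))"
proof (intro conjI)
  show "\<forall>x y. (x, y) \<noteq> (0, 0) \<longrightarrow> d22 x y \<simeq> d22 y x"
    using d22_swap by blast
next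
  have "(\<forall>D. deformation (d22 x y) D \<longrightarrow> (\<forall>\<^sub>F t in nhds 0. in_family_d22 (D t))) \<and>
       deforms_along_d22 UNIV (d22 x y)"
    if "(x, y) \<noteq> (0, 0)" "\<forall>p \<in> {(1, 0), (0, 1), (1, 1), (1, -1)}. \<not> proj_eq (x, y) p" for x y
    using deformation_in_family_d22 deforms_along_d22_non_fixed not_proj_eq_special[OF that]
    by (auto simp: power2_eq_iff)
  then show "\<forall>x y. (x, y) \<noteq> (0, 0) \<longrightarrow>
       (\<forall>p \<in> {(1, 0), (0, 1), (1, 1), (1, -1)}. \<not> proj_eq (x, y) p) \<longrightarrow>
       (\<forall>D. deformation (d22 x y) D \<longrightarrow> (\<forall>\<^sub>F t in nhds 0. in_family_d22 (D t))) \<and>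
       deforms_along_d22 UNIV (d22 x y)"
    by blast
next
  show "\<forall>m \<in> {d3, d4, d9, d10, d11, d13, d17}. has_jump_deformation (d22 1 0) m"
    using jump_d3 jump_d4 jump_d9 jump_d10 jump_d11 jump_d13 jump_d17 by blast
  show "deforms_along_d22 UNIV (d22 1 0)"
    by (rule deforms_along_d22_non_fixed) simp_all
next
  show "\<forall>m \<in> {d2, d5, d6, d12, d14, d16, d19}. has_jump_deformation (d22 1 1) m"
    using jump_d2 jump_d5 jump_d6 jump_d12 jump_d14 jump_d16 jump_d19 by blast
  show "deforms_along_d22 \<real> (d22 1 1)"
    by (rule deforms_along_d22_fixed) simp
next
  show "has_jump_deformation (d22 1 (-1)) d7"
    by (rule jump_d7)
  show "deforms_along_d22 \<real> (d22 1 (-1))"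
    by (rule deforms_along_d22_fixed) simp
qed

end
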